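(* Let $n\ge2$ and $1\le k\le n$. With the operators below, $\mathrm{SVT}^n(\Lambda_k)$ is a K-crystal, i.e.: (K.1) the graph on $\mathrm{SVT}^n(\Lambda_k)$ with edges $T\to f_iT$ and $T\to f_i^KT$ (nonzero) is connected, and $u$ is the only element with $e_iu=0$ and $e_i^Ku=0$ for all $i$; (K.2) for every $w\in S_n$ the set $\mathrm{SVT}^n_w(\Lambda_k)$ does not depend on the choice of reduced expression of $w$; (K.3) for every $w\in S_n$ with reduced expression $w=s_{i_1}\cdots s_{i_\ell}$, \[\sum_{T\in\mathrm{SVT}^n_w(\Lambda_k)}\beta^{\mathrm{ex}(T)}x^{\mathrm{wt}(T)}=\varpi_{i_1}\cdots\varpi_{i_\ell}\,x_1x_2\cdots x_k,\] the Lascoux polynomial $L_{w\lambda}$ for $\lambda=(1^k,0^{n-k})$.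
   Context: $\mathrm{SVT}^n(\Lambda_k)$ is the set of single-column semistandard set-valued tableaux of height $k$ with entries at most $n$: sequences of nonempty sets $A_1,\dots,A_k\subseteq\{1,\dots,n\}$ (top to bottom) with $\max A_r<\min A_{r+1}$. $\mathrm{wt}(T)=(c_1,\dots,c_n)$, $c_j$ = number of boxes containing $j$; $\mathrm{ex}(T)=\sum_r(|A_r|-1)$. $u$ is the column $\{1\},\{2\},\dots,\{k\}$. For $1\le i<n$: $f_iT=0$ unless $i\in T$ and $i+1\notin T$, in which case $f_iT$ replaces $i$ by $i+1$; $e_iT=0$ unless $i+1\in T$ and $i\notin T$, in which case $e_iT$ replaces $i+1$ by $i$. K-crystal operators: $f_i^KT=0$ if $i\notin T$ or $i+1\in T$; otherwise $f_i^KT$ adds $i+1$ to the box containing $i$. $e_i^KT=0$ if no box contains both $i$ and $i+1$; otherwise $e_i^KT$ deletes $i+1$ from that box. For $g\in\{e_i,e_i^K\}$, $g^{\max}T=g^rT$ with $r$ maximal with $g^rT\ne 0$. K-Demazure crystal for a reduced expression $w=s_{i_1}\cdots s_{i_\ell}$: $\mathrm{SVT}^n_w(\Lambda_k)=\{T:(e^K_{i_\ell})^{\max}e_{i_\ell}^{\max}\cdots(e^K_{i_1})^{\max}e_{i_1}^{\max}T=u\}$ (rightmost operator applied first). Demazure--Lascoux operators: $\partial_if=(f-s_if)/(x_i-x_{i+1})$ ($s_i$ swaps $x_i,x_{i+1}$), $\varpi_if=\partial_i((x_i+\beta x_ix_{i+1})f)$. *)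

theory Defs
  imports
    "HOL-Library.Poly_Mapping"
    "HOL-Computational_Algebra.Polynomial"
    "HOL-Combinatorics.Permutations"
begin

section \<open>Single-column set-valued tableaux\<close>

type_synonym column = "nat set list"

definition SVT :: "nat \<Rightarrow> nat \<Rightarrow> column set" where
  "SVT n k = {T. length T = k
      \<and> (\<forall>A\<in>set T. A \<noteq> {} \<and> A \<subseteq> {1..n})
      \<and> (\<forall>r. Suc r < k \<longrightarrow> Max (T ! r) < Min (T ! Suc r))}"

definition content :: "column \<Rightarrow> nat set" where
  "content T = \<Union> (set T)"

definition weight :: "column \<Rightarrow> nat \<Rightarrow> nat" where
  "weight T j = card {r. r < length T \<and> j \<in> T ! r}"

definition excess :: "column \<Rightarrow> nat" where
  "excess T = (\<Sum>r<length T. card (T ! r) - 1)"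

definition ucol :: "nat \<Rightarrow> column" where
  "ucol k = map (\<lambda>j. {j}) [1..<Suc k]"

section \<open>Crystal operators\<close>

text \<open>The value 0 of a crystal operator is rendered as \<^term>\<open>None\<close>.\<close>

definition f_op :: "nat \<Rightarrow> column \<Rightarrow> column option" where
  "f_op i T = (if i \<in> content T \<and> Suc i \<notin> content T
     then Some (map (\<lambda>A. if i \<in> A then insert (Suc i) (A - {i}) else A) T) else None)"

definition e_op :: "nat \<Rightarrow> column \<Rightarrow> column option" where
  "e_op i T = (if Suc i \<in> content T \<and> i \<notin> content T
     then Some (map (\<lambda>A. if Suc i \<in> A then insert i (A - {Suc i}) else A) T) else None)"

definition fK_op :: "nat \<Rightarrow> column \<Rightarrow> column option" where
  "fK_op i T = (if i \<in> content T \<and> Suc i \<notin> content T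
     then Some (map (\<lambda>A. if i \<in> A then insert (Suc i) A else A) T) else None)"

definition eK_op :: "nat \<Rightarrow> column \<Rightarrow> column option" where
  "eK_op i T = (if \<exists>A\<in>set T. i \<in> A \<and> Suc i \<in> A
     then Some (map (\<lambda>A. if i \<in> A \<and> Suc i \<in> A then A - {Suc i} else A) T) else None)"

definition op_pow :: "('a \<Rightarrow> 'a option) \<Rightarrow> nat \<Rightarrow> 'a \<Rightarrow> 'a option" where
  "op_pow g r T = ((\<lambda>X. Option.bind X g) ^^ r) (Some T)"

definition op_max :: "('a \<Rightarrow> 'a option) \<Rightarrow> 'a \<Rightarrow> 'a" where
  "op_max g T = the (op_pow g (GREATEST r. op_pow g r T \<noteq> None) T)"

definition svt_edges :: "nat \<Rightarrow> nat \<Rightarrow> (column \<times> column) set" where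
  "svt_edges n k = {(T, T'). T \<in> SVT n k \<and> T' \<in> SVT n k
      \<and> (\<exists>i\<in>{1..<n}. f_op i T = Some T' \<or> fK_op i T = Some T')}"

section \<open>Words in the simple transpositions\<close>

definition word_perm :: "nat list \<Rightarrow> nat \<Rightarrow> nat" where
  "word_perm is = foldr (\<lambda>i p. transpose i (Suc i) \<circ> p) is id"

definition reduced_word :: "nat \<Rightarrow> (nat \<Rightarrow> nat) \<Rightarrow> nat list \<Rightarrow> bool" where
  "reduced_word n w is \<longleftrightarrow> set is \<subseteq> {1..<n} \<and> word_perm is = w
      \<and> (\<forall>js. set js \<subseteq> {1..<n} \<and> word_perm js = w \<longrightarrow> length is \<le> length js)"

text \<open>The first letter of the word is the first one to act on the tableau.\<close>

definition SVT_word :: "nat \<Rightarrow> nat \<Rightarrow> nat list \<Rightarrow> column set" where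
  "SVT_word n k is = {T \<in> SVT n k.
      fold (\<lambda>i X. op_max (eK_op i) (op_max (e_op i) X)) is T = ucol k}"

section \<open>Demazure--Lascoux operators\<close>

text \<open>Polynomials in the variables \<open>x\<^sub>j\<close> (\<open>j\<close> any natural number) with coefficients in
  \<open>\<int>[\<beta>]\<close>; \<open>\<beta>\<close> is the indeterminate of the coefficient ring \<^typ>\<open>int poly\<close>.\<close>

type_synonym mpol = "(nat \<Rightarrow>\<^sub>0 nat) \<Rightarrow>\<^sub>0 int poly"

definition X :: "nat \<Rightarrow> mpol" where
  "X j = Poly_Mapping.single (Poly_Mapping.single j 1) 1"

definition Beta :: mpol where
  "Beta = Poly_Mapping.single 0 [:0, 1:]"

text \<open>\<^term>\<open>Poly_Mapping.map_key \<sigma>\<close> precomposes with an injective map \<open>\<sigma>\<close>; the inner occurrence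
  swaps two exponents of a monomial, the outer one re-indexes the coefficients accordingly.\<close>

definition swap_exps :: "nat \<Rightarrow> (nat \<Rightarrow>\<^sub>0 nat) \<Rightarrow> (nat \<Rightarrow>\<^sub>0 nat)" where
  "swap_exps i m = Poly_Mapping.map_key (transpose i (Suc i)) m"

definition swap_vars :: "nat \<Rightarrow> mpol \<Rightarrow> mpol" where
  "swap_vars i p = Poly_Mapping.map_key (swap_exps i) p"

text \<open>The quotient is taken in the integral domain of polynomials, where it exists and is unique
  (see \<open>divdiff_eq\<close> below).\<close>

definition divdiff :: "nat \<Rightarrow> mpol \<Rightarrow> mpol" where
  "divdiff i p = (THE q. (X i - X (Suc i)) * q = p - swap_vars i p)"

definition DL :: "nat \<Rightarrow> mpol \<Rightarrow> mpol" where
  "DL i p = divdiff i ((X i + Beta * X i * X (Suc i)) * p)"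

section \<open>Well-definedness\<close>

lemma finite_SVT: "finite (SVT n k)"
proof (rule finite_subset)
  show "SVT n k \<subseteq> {T. set T \<subseteq> Pow {1..n} \<and> length T = k}"
    by (auto simp: SVT_def)
qed (simp add: finite_lists_length_eq)

lemma SVT_iff:
  "T \<in> SVT n k \<longleftrightarrow> length T = k \<and> (\<forall>A\<in>set T. A \<noteq> {} \<and> A \<subseteq> {1..n})
     \<and> (\<forall>r. Suc r < k \<longrightarrow> (\<forall>a\<in>T ! r. \<forall>b\<in>T ! Suc r. a < b))"
proof -
  have *: "Max (T ! r) < Min (T ! Suc r) \<longleftrightarrow> (\<forall>a\<in>T ! r. \<forall>b\<in>T ! Suc r. a < b)"
    if len: "length T = k" and ne: "\<forall>A\<in>set T. A \<noteq> {} \<and> A \<subseteq> {1..n}" and r: "Suc r < k" for r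
  proof -
    have "T ! r \<in> set T" "T ! Suc r \<in> set T" using len r by simp_all
    with ne have "finite (T ! r)" "finite (T ! Suc r)" "T ! r \<noteq> {}" "T ! Suc r \<noteq> {}"
      by (simp_all add: finite_subset[of _ "{1..n}"])
    then show ?thesis by auto
  qed
  show ?thesis unfolding SVT_def mem_Collect_eq
    by (intro conj_cong refl iff_allI imp_cong) (rule *)
qed

text \<open>The operators preserve the set of tableaux, so the requirement \<open>T' \<in> SVT n k\<close> in
  \<^const>\<open>svt_edges\<close> loses no edges.\<close>

lemma ops_closed:
  assumes T: "T \<in> SVT n k" and i: "i \<in> {1..<n}"
    and g: "g \<in> {f_op i, e_op i, fK_op i, eK_op i}" and gT: "g T = Some T'"
  shows "T' \<in> SVT n k"
proof -
  have len: "length T = k"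
    and ne: "\<And>A. A \<in> set T \<Longrightarrow> A \<noteq> {} \<and> A \<subseteq> {1..n}"
    and lt: "\<And>r a b. Suc r < k \<Longrightarrow> a \<in> T ! r \<Longrightarrow> b \<in> T ! Suc r \<Longrightarrow> a < b"
    using T by (auto simp: SVT_iff)
  have mem: "\<And>r a. r < k \<Longrightarrow> a \<in> T ! r \<Longrightarrow> a \<in> content T"
    using len by (auto simp: content_def)
  consider "g = f_op i" | "g = e_op i" | "g = fK_op i" | "g = eK_op i" using g by auto
  then show ?thesis
  proof cases
    case 1
    with gT have c: "Suc i \<notin> content T"
      and T': "T' = map (\<lambda>A. if i \<in> A then insert (Suc i) (A - {i}) else A) T"
      by (auto simp: f_op_def split: if_splits)
    have "a < b" if r: "Suc r < k" and ab: "a \<in> T' ! r" "b \<in> T' ! Suc r" for r a b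
    proof -
      have "a \<in> T ! r \<or> (a = Suc i \<and> i \<in> T ! r)" "b \<in> T ! Suc r \<or> (b = Suc i \<and> i \<in> T ! Suc r)"
        using r ab len by (auto simp: T' split: if_splits)
      moreover have "b \<noteq> Suc i" if "b \<in> T ! Suc r" using that c mem[OF r] by blast
      ultimately show ?thesis using lt[OF r, of a b] lt[OF r, of i b] lt[OF r, of a i] lt[OF r, of i i]
        by (elim disjE conjE) (simp_all add: Suc_lessI)
    qed
    moreover have "\<forall>A\<in>set T'. A \<noteq> {} \<and> A \<subseteq> {1..n}"
      using ne i by (auto simp: T' split: if_splits)
    ultimately show ?thesis using len by (auto simp: SVT_iff T')
  next
    case 2
    with gT have c: "i \<notin> content T"
      and T': "T' = map (\<lambda>A. if Suc i \<in> A then insert i (A - {Suc i}) else A) T"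
      by (auto simp: e_op_def split: if_splits)
    have "a < b" if r: "Suc r < k" and ab: "a \<in> T' ! r" "b \<in> T' ! Suc r" for r a b
    proof -
      have "a \<in> T ! r \<or> (a = i \<and> Suc i \<in> T ! r)" "b \<in> T ! Suc r \<or> (b = i \<and> Suc i \<in> T ! Suc r)"
        using r ab len by (auto simp: T' split: if_splits)
      moreover have "a \<noteq> i" if "a \<in> T ! r" using that c mem[of r a] r by auto
      ultimately show ?thesis using lt[OF r, of a b] lt[OF r, of "Suc i" b] lt[OF r, of a "Suc i"]
        lt[OF r, of "Suc i" "Suc i"]
        by (elim disjE conjE) (simp_all add: less_Suc_eq)
    qed
    moreover have "\<forall>A\<in>set T'. A \<noteq> {} \<and> A \<subseteq> {1..n}"
      using ne i by (auto simp: T' split: if_splits)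
    ultimately show ?thesis using len by (auto simp: SVT_iff T')
  next
    case 3
    with gT have c: "Suc i \<notin> content T"
      and T': "T' = map (\<lambda>A. if i \<in> A then insert (Suc i) A else A) T"
      by (auto simp: fK_op_def split: if_splits)
    have "a < b" if r: "Suc r < k" and ab: "a \<in> T' ! r" "b \<in> T' ! Suc r" for r a b
    proof -
      have "a \<in> T ! r \<or> (a = Suc i \<and> i \<in> T ! r)" "b \<in> T ! Suc r \<or> (b = Suc i \<and> i \<in> T ! Suc r)"
        using r ab len by (auto simp: T' split: if_splits)
      moreover have "b \<noteq> Suc i" if "b \<in> T ! Suc r" using that c mem[OF r] by blast
      ultimately show ?thesis using lt[OF r, of a b] lt[OF r, of i b] lt[OF r, of a i] lt[OF r, of i i]
        by (elim disjE conjE) (simp_all add: Suc_lessI)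
    qed
    moreover have "\<forall>A\<in>set T'. A \<noteq> {} \<and> A \<subseteq> {1..n}"
      using ne i by (auto simp: T' split: if_splits)
    ultimately show ?thesis using len by (auto simp: SVT_iff T')
  next
    case 4
    with gT have T': "T' = map (\<lambda>A. if i \<in> A \<and> Suc i \<in> A then A - {Suc i} else A) T"
      by (auto simp: eK_op_def split: if_splits)
    have "a < b" if r: "Suc r < k" and ab: "a \<in> T' ! r" "b \<in> T' ! Suc r" for r a b
      using r ab len lt[OF r] by (auto simp: T' split: if_splits)
    moreover have "\<forall>A\<in>set T'. A \<noteq> {} \<and> A \<subseteq> {1..n}"
      using ne i by (fastforce simp: T' split: if_splits)
    ultimately show ?thesis using len by (auto simp: SVT_iff T')
  qed
qed

lemma inj_transpose: "inj (transpose a b)"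
  by (rule injI) (metis transpose_involutory)

lemma swap_exps_invol: "swap_exps i (swap_exps i m) = m"
  unfolding swap_exps_def
  by (rule poly_mapping_eqI) (simp add: map_key.rep_eq[OF inj_transpose])

lemma inj_swap_exps: "inj (swap_exps i)"
  by (rule injI) (metis swap_exps_invol)

lemma swap_vars_single:
  "swap_vars i (Poly_Mapping.single m c) = Poly_Mapping.single (swap_exps i m) c"
  unfolding swap_vars_def
  using map_key_single[OF inj_swap_exps, of i "swap_exps i m" c] by (simp add: swap_exps_invol)

lemma swap_vars_add: "swap_vars i (p + q) = swap_vars i p + swap_vars i q"
  unfolding swap_vars_def by (rule map_key_plus[OF inj_swap_exps])

lemma X_power: "X j ^ a = Poly_Mapping.single (Poly_Mapping.single j a) 1"
  by (induction a) (simp_all add: X_def mult_single flip: single_add)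

lemma dvd_swap_power:
  fixes x y :: "'a::comm_ring_1"
  shows "(x - y) dvd (x ^ a * y ^ b - x ^ b * y ^ a)"
proof -
  have *: "(x - y) dvd (x ^ (b + d) * y ^ b - x ^ b * y ^ (b + d))" for b d
  proof -
    have "x ^ (b + d) * y ^ b - x ^ b * y ^ (b + d) = x ^ b * y ^ b * (x ^ d - y ^ d)"
      by (simp add: power_add algebra_simps)
    moreover have "(x - y) dvd (x ^ d - y ^ d)"
      by (metis dvd_triv_left power_diff_sumr2)
    ultimately show ?thesis by simp
  qed
  show ?thesis
  proof (cases "b \<le> a")
    case True
    then show ?thesis using *[of b "a - b"] by simp
  next
    case False
    then have "(x - y) dvd - (x ^ a * y ^ b - x ^ b * y ^ a)"
      using *[of a "b - a"] by simp
    then show ?thesis by (simp only: dvd_minus_iff)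
  qed
qed

lemma divdiff_dvd: "(X i - X (Suc i)) dvd (p - swap_vars i p)"
proof (induction p rule: update_induct)
  case const
  then show ?case by (simp add: swap_vars_def map_key_zero[OF inj_swap_exps])
next
  case (update p m c)
  have upd: "Poly_Mapping.update m c p = p + Poly_Mapping.single m c"
    using update.hyps
    by (intro poly_mapping_eqI) (auto simp: lookup_update lookup_add lookup_single in_keys_iff)
  define a where "a = Poly_Mapping.lookup m i"
  define b where "b = Poly_Mapping.lookup m (Suc i)"
  define r where "r = Poly_Mapping.update i 0 (Poly_Mapping.update (Suc i) 0 m)"
  have m: "m = Poly_Mapping.single i a + Poly_Mapping.single (Suc i) b + r"
    by (intro poly_mapping_eqI)
      (auto simp: a_def b_def r_def lookup_update lookup_add lookup_single when_def)
  have sm: "swap_exps i m = Poly_Mapping.single i b + Poly_Mapping.single (Suc i) a + r"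
    unfolding swap_exps_def
    by (intro poly_mapping_eqI)
      (auto simp: a_def b_def r_def lookup_update lookup_add lookup_single when_def
        map_key.rep_eq[OF inj_transpose] transpose_def)
  have "Poly_Mapping.single m c - Poly_Mapping.single (swap_exps i m) c
      = (X i ^ a * X (Suc i) ^ b - X i ^ b * X (Suc i) ^ a) * Poly_Mapping.single r c"
    unfolding m sm[unfolded m] by (simp add: X_power mult_single algebra_simps)
  then have "(X i - X (Suc i)) dvd (Poly_Mapping.single m c - Poly_Mapping.single (swap_exps i m) c)"
    by (simp add: dvd_swap_power)
  with update.IH have "(X i - X (Suc i)) dvd (p - swap_vars i p
      + (Poly_Mapping.single m c - Poly_Mapping.single (swap_exps i m) c))"
    by (rule dvd_add)
  then show ?case
    by (simp add: upd swap_vars_add swap_vars_single algebra_simps)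
qed

lemma divdiff_eq: "(X i - X (Suc i)) * divdiff i p = p - swap_vars i p"
proof -
  have "Poly_Mapping.single i (1::nat) \<noteq> Poly_Mapping.single (Suc i) 1"
    by (metis lookup_single_eq lookup_single_not_eq n_not_Suc_n zero_neq_one)
  then have nz: "X i - X (Suc i) \<noteq> 0"
    unfolding X_def by (metis eq_iff_diff_eq_0 lookup_single_eq lookup_single_not_eq zero_neq_one)
  obtain q where q: "(X i - X (Suc i)) * q = p - swap_vars i p"
    using divdiff_dvd by (metis dvdE)
  show ?thesis unfolding divdiff_def
    by (rule theI[of _ q]) (use q nz in \<open>metis mult_left_cancel\<close>)+
qed

end

theory Submission
  imports Defs
begin

text \<open>The composite of the two maximal raising operators for \<open>i\<close> collapses an \<open>i\<close>-string
  \<open>{T, f\<^sub>i T, f\<^sub>i\<^sup>K T}\<close> to its head \<open>T\<close> and fixes all other tableaux. On the set of maxima of the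
  boxes it acts as the ordinary crystal operator on \<open>k\<close>-subsets, and a tableau is determined to be
  \<open>u\<close> by its maxima. Hence \<open>T\<close> lies in the K-Demazure crystal of \<open>w\<close> iff the sorted maxima of \<open>T\<close> are
  componentwise at most the sorted elements of \<open>w {1..k}\<close>, a condition that mentions no reduced word.
  Such a set meets every \<open>i\<close>-string in nothing, in its head or in the whole string; the
  Demazure--Lascoux operator fixes the symmetric sum over a whole string and sends the monomial of
  the head to that sum.\<close>

subsection \<open>Combinatorics of single columns\<close>

text \<open>One letter's share of the fold in \<open>SVT_word\<close>.\<close>

definition step :: "nat \<Rightarrow> column \<Rightarrow> column" where
  "step i T = op_max (eK_op i) (op_max (e_op i) T)"

text \<open>Each value lies in at most one box of a tableau, so here \<open>i\<close> and
  \<open>Suc i\<close> occupy different boxes and neither raising operator for \<open>i\<close> is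
  defined.\<close>

definition separated :: "nat \<Rightarrow> column \<Rightarrow> bool" where
  "separated i T \<longleftrightarrow> Suc i \<in> content T \<and> (\<exists>A\<in>set T. i \<in> A \<and> Suc i \<notin> A)"

text \<open>Taking images under this map merges \<open>i\<close> and \<open>Suc i\<close>, so it
  models both the replacement made by \<open>e_op\<close> and the deletion made by
  \<open>eK_op\<close>.\<close>

definition lower :: "nat \<Rightarrow> nat \<Rightarrow> nat" where
  "lower i a = (if a = Suc i then i else a)"

definition maxima :: "column \<Rightarrow> nat set" where
  "maxima T = Max ` set T"

section \<open>Maximal powers of partial operators\<close>

lemma op_pow_Suc:
  "op_pow g (Suc r) T = (case g T of None \<Rightarrow> None | Some T' \<Rightarrow> op_pow g r T')"
proof -
  have "((\<lambda>X. Option.bind X g) ^^ r) None = None" for r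
    by (induction r) auto
  then show ?thesis
    unfolding op_pow_def funpow_Suc_right by (simp split: option.split)
qed

lemma op_pow_0: "op_pow g 0 T = Some T"
  by (simp add: op_pow_def)

lemma op_max_None:
  assumes "g T = None" shows "op_max g T = T"
proof -
  have "op_pow g r T \<noteq> None \<longleftrightarrow> r = 0" for r
    using assms by (cases r) (auto simp: op_pow_Suc op_pow_0)
  then have "(GREATEST r. op_pow g r T \<noteq> None) = 0"
    by (intro Greatest_equality) auto
  then show ?thesis by (simp only: op_max_def) (simp add: op_pow_0)
qed

text \<open>Enough for tableaux: one application of \<open>e_op i\<close> or \<open>eK_op i\<close>
  removes \<open>Suc i\<close> from the content, so neither can be applied again.\<close>

lemma op_max_Some:
  assumes "g T = Some T'" "g T' = None" shows "op_max g T = T'"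
proof -
  have 1: "op_pow g 1 T = Some T'"
    using assms by (simp add: op_pow_Suc op_pow_0)
  have "r \<le> 1" if "op_pow g r T \<noteq> None" for r
  proof (rule ccontr)
    assume "\<not> r \<le> 1"
    then obtain q where "r = Suc (Suc q)" by (metis not_less_eq_eq One_nat_def Suc_le_D le_Suc_eq nat_le_linear)
    with that assms show False by (simp add: op_pow_Suc)
  qed
  with 1 have "(GREATEST r. op_pow g r T \<noteq> None) = 1"
    by (intro Greatest_equality) auto
  then show ?thesis using 1 by (simp only: op_max_def) simp
qed

section \<open>Order and disjointness of boxes\<close>

lemma SVT_box:
  assumes "T \<in> SVT n k" "A \<in> set T"
  shows "A \<noteq> {}" "A \<subseteq> {1..n}" "finite A"
  using assms finite_subset[of A "{1..n}"] by (auto simp: SVT_iff)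

lemma SVT_content: "T \<in> SVT n k \<Longrightarrow> content T \<subseteq> {1..n}"
  using SVT_box(2) by (fastforce simp: content_def)

text \<open>Nonempty intermediate boxes make the condition on neighbouring boxes transitive.\<close>

lemma SVT_less:
  assumes "T \<in> SVT n k" "r < s" "s < k" "a \<in> T ! r" "b \<in> T ! s"
  shows "a < b"
  using assms(2,3,5)
proof (induction s arbitrary: b)
  case (Suc s)
  show ?case
  proof (cases "r = s")
    case True
    then show ?thesis using assms(1,4) Suc.prems by (auto simp: SVT_iff)
  next
    case False
    have "T ! s \<noteq> {}" using Suc.prems assms(1) by (auto simp: SVT_iff)
    then obtain c where c: "c \<in> T ! s" by blast
    then have "a < c" using Suc False by simp
    moreover have "c < b" using c Suc.prems assms(1) by (auto simp: SVT_iff)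
    ultimately show ?thesis by simp
  qed
qed simp

lemma SVT_index_unique:
  assumes "T \<in> SVT n k" "r < k" "s < k" "a \<in> T ! r" "a \<in> T ! s"
  shows "r = s"
  using SVT_less[OF assms(1), of r s a a] SVT_less[OF assms(1), of s r a a] assms
  by (metis less_irrefl linorder_neqE_nat)

lemma SVT_box_unique:
  assumes "T \<in> SVT n k" "A \<in> set T" "B \<in> set T" "a \<in> A" "a \<in> B"
  shows "A = B"
  using SVT_index_unique[OF assms(1)] assms by (auto simp: in_set_conv_nth SVT_iff)

text \<open>A later box would put \<open>b\<close> above \<open>c\<close>, an earlier one below
  \<open>a\<close>.\<close>

lemma SVT_box_between:
  assumes T: "T \<in> SVT n k" and A: "A \<in> set T" "a \<in> A" "c \<in> A"
    and b: "b \<in> content T" "a \<le> b" "b \<le> c"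
  shows "b \<in> A"
proof -
  have len: "length T = k" using T by (simp add: SVT_iff)
  obtain r where r: "r < k" "A = T ! r" using A(1) len by (auto simp: in_set_conv_nth)
  obtain s where s: "s < k" "b \<in> T ! s" using b(1) len by (auto simp: content_def in_set_conv_nth)
  have "r = s"
    using SVT_less[OF T, of r s c b] SVT_less[OF T, of s r b a] r s A b
    by (metis leD linorder_neqE_nat)
  with r s show ?thesis by simp
qed

lemma content_map_image: "content (map (image f) T) = f ` content T"
  by (auto simp: content_def)

lemma map_lower_id:
  assumes "Suc i \<notin> content T"
  shows "map (image (lower i)) T = T"
proof (rule map_idI)
  fix A assume "A \<in> set T"
  with assms have "Suc i \<notin> A" by (auto simp: content_def)
  then show "lower i ` A = A" by (force simp: lower_def)
qed

lemma Suc_notin_lower: "Suc i \<notin> lower i ` S"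
  by (auto simp: lower_def)

section \<open>The composite raising operator\<close>

lemma eK_op_None_iff: "eK_op i T = None \<longleftrightarrow> (\<forall>A\<in>set T. \<not> (i \<in> A \<and> Suc i \<in> A))"
  by (auto simp: eK_op_def)

lemma e_op_None_iff: "e_op i T = None \<longleftrightarrow> (Suc i \<in> content T \<longrightarrow> i \<in> content T)"
  by (auto simp: e_op_def)

lemma ops_None_if_Suc_notin:
  assumes "Suc i \<notin> content T"
  shows "e_op i T = None" "eK_op i T = None"
  using assms by (auto simp: e_op_None_iff eK_op_None_iff content_def)

lemma separated_ops_None:
  assumes T: "T \<in> SVT n k" and "separated i T"
  shows "e_op i T = None" "eK_op i T = None"
proof -
  obtain A where A: "A \<in> set T" "i \<in> A" "Suc i \<notin> A"
    using assms by (auto simp: separated_def)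
  then show "e_op i T = None" by (auto simp: e_op_None_iff content_def)
  show "eK_op i T = None"
    unfolding eK_op_None_iff using SVT_box_unique[OF T A(1) _ A(2)] A(3) by blast
qed

text \<open>If \<open>Suc i\<close> is absent, \<open>lower i\<close> changes nothing. If it occurs
  without \<open>i\<close>, \<open>e_op\<close> moves; if it shares a box with \<open>i\<close>,
  \<open>eK_op\<close> moves; both have the effect of \<open>lower i\<close>. The remaining case is
  \<open>separated\<close>.\<close>

lemma step_eq:
  assumes T: "T \<in> SVT n k"
  shows "step i T = (if separated i T then T else map (image (lower i)) T)"
proof -
  let ?T = "map (image (lower i)) T"
  \<comment> \<open>No \<open>Suc i\<close> is left, so each maximal power stops after one
    application and \<open>eK_op\<close> cannot follow \<open>e_op\<close>.\<close>
  have T'None: "e_op i ?T = None" "eK_op i ?T = None"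
    by (rule ops_None_if_Suc_notin; simp add: content_map_image Suc_notin_lower)+
  consider "Suc i \<notin> content T" | "separated i T" | "Suc i \<in> content T" "i \<notin> content T"
    | "Suc i \<in> content T" "i \<in> content T" "\<not> separated i T" by blast
  then show ?thesis
  proof cases
    case 1
    then show ?thesis
      by (simp add: step_def op_max_None ops_None_if_Suc_notin map_lower_id)
  next
    case 2
    then show ?thesis
      by (simp add: step_def op_max_None separated_ops_None[OF T])
  next
    case 3
    have "map (\<lambda>A. if Suc i \<in> A then insert i (A - {Suc i}) else A) T = ?T"
      by (rule map_cong) (force simp: lower_def)+
    then have "e_op i T = Some ?T" using 3 by (simp add: e_op_def)
    moreover have "\<not> separated i T" using 3 by (auto simp: separated_def content_def)
    ultimately show ?thesis
      using T'None by (simp add: step_def op_max_None op_max_Some)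
  next
    case 4
    then obtain B where B: "B \<in> set T" "i \<in> B" "Suc i \<in> B"
      by (auto simp: separated_def content_def)
    have "map (\<lambda>A. if i \<in> A \<and> Suc i \<in> A then A - {Suc i} else A) T = ?T"
    proof (rule map_cong[OF refl])
      fix A assume "A \<in> set T"
      with SVT_box_unique[OF T B(1) _ B(3)] B have "Suc i \<in> A \<longrightarrow> i \<in> A" by blast
      then show "(if i \<in> A \<and> Suc i \<in> A then A - {Suc i} else A) = lower i ` A"
        by (force simp: lower_def)
    qed
    then have "eK_op i T = Some ?T" using B by (auto simp: eK_op_def)
    moreover have "e_op i T = None" using 4 by (simp add: e_op_None_iff)
    ultimately show ?thesis
      using T'None 4 by (simp add: step_def op_max_None op_max_Some)
  qed
qed

text \<open>\<open>lower i\<close> can break the strict order of neighbouring boxes only if one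
  holds \<open>i\<close> and the next \<open>Suc i\<close>; this is the separated case, where
  nothing moves.\<close>

lemma step_in_SVT:
  assumes T: "T \<in> SVT n k" and i: "i \<in> {1..<n}"
  shows "step i T \<in> SVT n k"
proof (cases "separated i T")
  case False
  have len: "length T = k" using T by (simp add: SVT_iff)
  have "lower i a < lower i b" if r: "Suc r < k" and ab: "a \<in> T ! r" "b \<in> T ! Suc r" for r a b
  proof -
    have "a < b" using SVT_less[OF T _ r ab] by simp
    moreover have "\<not> (a = i \<and> b = Suc i)"
    proof
      assume *: "a = i \<and> b = Suc i"
      then have "Suc i \<notin> T ! r"
        using SVT_index_unique[OF T, of r "Suc r" "Suc i"] r ab by auto
      moreover have "T ! r \<in> set T" "T ! Suc r \<in> set T" using r len by simp_all
      ultimately show False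
        using False ab * unfolding separated_def content_def by blast
    qed
    ultimately show ?thesis by (auto simp: lower_def)
  qed
  moreover have "\<forall>A\<in>set T. lower i ` A \<subseteq> {1..n}"
    using SVT_box[OF T] i by (fastforce simp: lower_def)
  ultimately have "map (image (lower i)) T \<in> SVT n k"
    using T by (auto simp: SVT_iff)
  then show ?thesis using False by (simp add: step_eq[OF T])
qed (use T in \<open>simp add: step_eq[OF T]\<close>)

text \<open>In the separated case \<open>i\<close> is itself a box maximum. Otherwise
  \<open>lower i\<close> is monotone and hence commutes with \<open>Max\<close>; should
  \<open>i\<close> be a maximum, \<open>Suc i\<close> is absent and \<open>lower i\<close> is
  trivial on the maxima.\<close>

lemma maxima_step:
  assumes T: "T \<in> SVT n k"
  shows "maxima (step i T) = (if i \<in> maxima T then maxima T else lower i ` maxima T)"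
proof (cases "separated i T")
  case True
  then obtain A where A: "A \<in> set T" "i \<in> A" "Suc i \<notin> A" and c: "Suc i \<in> content T"
    by (auto simp: separated_def)
  \<comment> \<open>An element of \<open>A\<close> above \<open>i\<close> would trap
    \<open>Suc i\<close> inside \<open>A\<close>.\<close>
  have "b \<le> i" if "b \<in> A" for b
    using SVT_box_between[OF T A(1,2) that c] A(3) by linarith
  then have "Max A = i" using A(2) SVT_box(3)[OF T A(1)] by (intro Max_eqI) auto
  then have "i \<in> maxima T" using A(1) by (auto simp: maxima_def)
  with True show ?thesis by (simp add: step_eq[OF T])
next
  case False
  have "Max (lower i ` A) = lower i (Max A)" if "A \<in> set T" for A
    using SVT_box[OF T that]
    by (intro mono_Max_commute[symmetric] monoI) (auto simp: lower_def)
  then have eq: "maxima (step i T) = lower i ` maxima T"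
    using False by (auto simp: step_eq[OF T] maxima_def image_image)
  moreover have "lower i ` maxima T = maxima T" if i: "i \<in> maxima T"
  proof -
    obtain A where A: "A \<in> set T" "Max A = i" using i by (auto simp: maxima_def)
    then have "i \<in> A" "Suc i \<notin> A"
      using SVT_box[OF T A(1)] Max_in Max_ge[of A "Suc i"] by auto
    then have "Suc i \<notin> content T" using False A(1) by (auto simp: separated_def)
    then have "Suc i \<notin> maxima T"
      using SVT_box[OF T] Max_in by (fastforce simp: maxima_def content_def)
    then show ?thesis by (force simp: lower_def)
  qed
  ultimately show ?thesis by simp
qed

section \<open>The highest weight tableau\<close>

lemma nth_ucol: "r < k \<Longrightarrow> ucol k ! r = {Suc r}"
  by (simp add: ucol_def del: upt_Suc)

lemma length_ucol: "length (ucol k) = k"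
  by (simp add: ucol_def)

text \<open>Determine the boxes from the top. An unwanted entry \<open>b = Suc i\<close> of box
  \<open>r\<close> has \<open>i > r\<close>, and since \<open>e_op i\<close> is undefined
  \<open>i\<close> occurs too: the earlier boxes \<open>{1}, ..., {r}\<close> are too small for it,
  the same box would allow \<open>eK_op i\<close>, and a later box violates the order.\<close>

lemma unique_highest:
  assumes T: "T \<in> SVT n k"
    and e: "\<And>i. i \<in> {1..<n} \<Longrightarrow> e_op i T = None \<and> eK_op i T = None"
  shows "T = ucol k"
proof -
  have len: "length T = k" using T by (simp add: SVT_iff)
  have "T ! r = {Suc r}" if "r < k" for r
    using that
  proof (induction r rule: less_induct)
    case (less r)
    have box: "T ! r \<in> set T" using less.prems len by simp
    have "b = Suc r" if b: "b \<in> T ! r" for b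
    proof (rule ccontr)
      assume ne: "b \<noteq> Suc r"
      have "Suc r \<le> b"
      proof (cases r)
        case 0
        then show ?thesis using SVT_box(2)[OF T box] b by auto
      next
        case (Suc q)
        then have "T ! q = {Suc q}" using less by simp
        then show ?thesis using SVT_less[OF T, of q r "Suc q" b] Suc less.prems b by simp
      qed
      with ne obtain i where i: "b = Suc i" "r < i" by (cases b) auto
      have "b \<le> n" using SVT_box(2)[OF T box] b by auto
      then have N: "e_op i T = None" "eK_op i T = None" using e[of i] i by auto
      have "i \<in> content T" using N(1) b box i by (auto simp: e_op_None_iff content_def)
      then obtain s where s: "s < k" "i \<in> T ! s"
        using len by (auto simp: content_def in_set_conv_nth)
      consider "s < r" | "s = r" | "r < s" by linarith
      then show False
      proof cases
        case 1
        then show False using less.IH[of s] s i by simp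
      next
        case 2
        then show False using N(2) box b s i by (auto simp: eK_op_None_iff)
      next
        case 3
        then show False using SVT_less[OF T 3 s(1) b s(2)] i by simp
      qed
    qed
    then show ?case using SVT_box(1)[OF T box] by blast
  qed
  then show ?thesis
    using len by (intro nth_equalityI) (auto simp: length_ucol nth_ucol)
qed

lemma set_ucol: "set (ucol k) = (\<lambda>j. {j}) ` {1..k}"
  by (auto simp: ucol_def)

lemma content_ucol: "content (ucol k) = {1..k}"
  by (simp add: content_def set_ucol)

lemma maxima_ucol: "maxima (ucol k) = {1..k}"
  by (simp add: maxima_def set_ucol image_image)

lemma ucol_in_SVT: "k \<le> n \<Longrightarrow> ucol k \<in> SVT n k"
  by (auto simp: SVT_iff set_ucol length_ucol nth_ucol)

lemma ucol_ops_None: "1 \<le> i \<Longrightarrow> e_op i (ucol k) = None \<and> eK_op i (ucol k) = None"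
  by (auto simp: e_op_None_iff eK_op_None_iff content_ucol set_ucol)

lemma finite_maxima: "finite (maxima T)"
  by (simp add: maxima_def)

lemma Max_box_content: "T \<in> SVT n k \<Longrightarrow> A \<in> set T \<Longrightarrow> Max A \<in> A"
  using SVT_box by simp

lemma card_maxima:
  assumes T: "T \<in> SVT n k"
  shows "card (maxima T) = k"
proof -
  have len: "length T = k" using T by (simp add: SVT_iff)
  have "maxima T = (\<lambda>r. Max (T ! r)) ` {..<k}"
    by (auto simp: maxima_def len[symmetric] set_conv_nth)
  moreover have "inj_on (\<lambda>r. Max (T ! r)) {..<k}"
  proof (rule inj_onI)
    fix r s assume "r \<in> {..<k}" "s \<in> {..<k}" "Max (T ! r) = Max (T ! s)"
    then show "r = s"
      using SVT_index_unique[OF T, of r s "Max (T ! r)"] Max_box_content[OF T] len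
      by (metis lessThan_iff nth_mem)
  qed
  ultimately show ?thesis by (simp add: card_image)
qed

text \<open>A nonmaximal entry of a box would lie in \<open>{1..k}\<close> and so be the maximum of
  another box, against disjointness. Thus all boxes are singletons, the content is
  \<open>{1..k}\<close>, and no raising operator applies.\<close>

lemma ucol_if_maxima:
  assumes T: "T \<in> SVT n k" and M: "maxima T = {1..k}"
  shows "T = ucol k"
proof (rule unique_highest[OF T])
  fix i assume i: "i \<in> {1..<n}"
  have le: "b \<in> {1..k}" if "b \<in> A" "A \<in> set T" for A b
  proof -
    have "b \<le> Max A" "1 \<le> b" using SVT_box[OF T that(2)] that by auto
    moreover have "Max A \<in> {1..k}" using that(2) M by (auto simp: maxima_def)
    ultimately show ?thesis by simp
  qed
  have single: "b = Max A" if b: "b \<in> A" and A: "A \<in> set T" for A b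
  proof -
    have "b \<in> maxima T" unfolding M by (rule le[OF b A])
    then obtain B where "B \<in> set T" "b = Max B" by (auto simp: maxima_def)
    then show ?thesis
      using SVT_box_unique[OF T A _ b] Max_box_content[OF T] by metis
  qed
  have "content T = {1..k}"
  proof
    show "content T \<subseteq> {1..k}" using le by (auto simp: content_def)
    show "{1..k} \<subseteq> content T"
      unfolding M[symmetric] using Max_box_content[OF T] by (auto simp: maxima_def content_def)
  qed
  then show "e_op i T = None \<and> eK_op i T = None"
    using single i by (auto simp: e_op_None_iff eK_op_None_iff) (metis n_not_Suc_n)
qed

subsection \<open>Dominance order and reduced words\<close>

text \<open>For sets of equal size, the counting condition says that the sorted elements of \<open>M\<close> are
  componentwise at most those of \<open>J\<close>.\<close>

definition dominated :: "nat set \<Rightarrow> nat set \<Rightarrow> bool" where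
  "dominated J M \<longleftrightarrow> (\<forall>m. card (J \<inter> {..<m}) \<le> card (M \<inter> {..<m}))"

lemma card_below_Suc:
  fixes S :: "nat set"
  shows "card (S \<inter> {..<Suc m}) = card (S \<inter> {..<m}) + (if m \<in> S then 1 else 0)"
proof -
  have "S \<inter> {..<Suc m} = (if m \<in> S then insert m (S \<inter> {..<m}) else S \<inter> {..<m})"
    by (auto simp: less_Suc_eq)
  then show ?thesis by simp
qed

text \<open>Unless its bound separates \<open>i\<close> from \<open>Suc i\<close>, an initial
  segment is mapped to itself by the transposition.\<close>

lemma card_below_swap:
  assumes "m \<noteq> Suc i"
  shows "card (transpose i (Suc i) ` S \<inter> {..<m}) = card (S \<inter> {..<m})"
proof -
  have "transpose i (Suc i) ` {..<m} = {..<m}"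
  proof (cases "m \<le> i")
    case True
    then have "\<forall>a\<in>{..<m}. transpose i (Suc i) a = a" by (auto simp: transpose_def)
    then show ?thesis by simp
  next
    case False
    then show ?thesis using assms by (intro transpose_image_eq) auto
  qed
  then have "transpose i (Suc i) ` S \<inter> {..<m} = transpose i (Suc i) ` (S \<inter> {..<m})"
    by (simp add: image_Int inj_transpose)
  then show ?thesis by (simp add: card_image inj_on_subset[OF inj_transpose])
qed

lemma lower_image_swap: "i \<notin> M \<Longrightarrow> lower i ` M = transpose i (Suc i) ` M"
  by (rule image_cong) (auto simp: lower_def transpose_def)

lemma transpose_image_commute:
  "inj f \<Longrightarrow> f (transpose a b x) = transpose (f a) (f b) (f x)"
  by (simp add: transpose_def inj_eq)

lemma transpose_image_mem: "a \<in> transpose i j ` S \<longleftrightarrow> transpose i j a \<in> S"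
  by (metis (no_types, lifting) image_iff transpose_involutory)

text \<open>The hypothesis says that the transposition raises \<open>J\<close> or fixes it, that is, \<open>s\<^sub>i J \<ge> J\<close>.\<close>

lemma dominated_step:
  assumes J: "Suc i \<in> J \<Longrightarrow> i \<in> J"
  shows "dominated J (if i \<in> M then M else lower i ` M)
    \<longleftrightarrow> dominated (transpose i (Suc i) ` J) M"
proof -
  let ?s = "transpose i (Suc i)"
  let ?M = "if i \<in> M then M else lower i ` M"
  have M: "card (?M \<inter> {..<m}) = card (M \<inter> {..<m})" if "m \<noteq> Suc i" for m
    using card_below_swap[OF that] by (simp add: lower_image_swap)
  have Mi: "card (?M \<inter> {..<Suc i})
      = card (M \<inter> {..<i}) + (if i \<in> M \<or> Suc i \<in> M then 1 else 0)"
    using M[of i] by (simp add: card_below_Suc lower_image_swap transpose_image_mem)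
  have Ji: "card (?s ` J \<inter> {..<Suc i}) = card (J \<inter> {..<i}) + (if Suc i \<in> J then 1 else 0)"
    by (simp add: card_below_Suc card_below_swap transpose_image_mem)
  have M2: "card (S \<inter> {..<Suc (Suc i)}) = card (S \<inter> {..<i})
      + (if i \<in> S then 1 else 0) + (if Suc i \<in> S then 1 else 0)" for S
    by (simp add: card_below_Suc)
  \<comment> \<open>\<open>P\<close> gathers the thresholds other than \<open>Suc i\<close>, where
    neither raising \<open>M\<close> nor swapping \<open>J\<close> changes a count.\<close>
  define P where "P \<longleftrightarrow> (\<forall>m. m \<noteq> Suc i \<longrightarrow> card (J \<inter> {..<m}) \<le> card (M \<inter> {..<m}))"
  have split: "dominated A B \<longleftrightarrow> (\<forall>m. m \<noteq> Suc i \<longrightarrow> card (A \<inter> {..<m}) \<le> card (B \<inter> {..<m}))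
      \<and> card (A \<inter> {..<Suc i}) \<le> card (B \<inter> {..<Suc i})" for A B
    unfolding dominated_def by metis
  have 1: "dominated J ?M \<longleftrightarrow> P \<and> card (J \<inter> {..<Suc i}) \<le> card (?M \<inter> {..<Suc i})"
    unfolding split P_def by (simp only: M simp_thms cong: imp_cong)
  have 2: "dominated (?s ` J) M \<longleftrightarrow> P \<and> card (?s ` J \<inter> {..<Suc i}) \<le> card (M \<inter> {..<Suc i})"
    unfolding split P_def by (simp only: card_below_swap simp_thms cong: imp_cong)
  \<comment> \<open>Both inequalities follow from \<open>P\<close>. They are clear if the counts
    below \<open>i\<close> differ; if these agree, the threshold \<open>Suc (Suc i)\<close> compares
    how many of \<open>i\<close> and \<open>Suc i\<close> lie in \<open>J\<close> and in
    \<open>M\<close>, and \<open>J\<close> contains \<open>Suc i\<close> only together with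
    \<open>i\<close>.\<close>
  have "card (J \<inter> {..<Suc i}) \<le> card (?M \<inter> {..<Suc i})
      \<longleftrightarrow> card (?s ` J \<inter> {..<Suc i}) \<le> card (M \<inter> {..<Suc i})" if P
  proof -
    from \<open>P\<close> have "card (J \<inter> {..<i}) \<le> card (M \<inter> {..<i})"
      "card (J \<inter> {..<Suc (Suc i)}) \<le> card (M \<inter> {..<Suc (Suc i)})"
      by (auto simp: P_def)
    then show ?thesis
      unfolding Mi Ji M2 using J by (auto simp: card_below_Suc split: if_splits)
  qed
  with 1 2 show ?thesis by blast
qed

text \<open>The threshold \<open>Suc k\<close> forces all \<open>k\<close> maxima to be at most
  \<open>k\<close>.\<close>

lemma dominated_initial:
  assumes T: "T \<in> SVT n k" and d: "dominated {1..k} (maxima T)"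
  shows "T = ucol k"
proof (rule ucol_if_maxima[OF T])
  have "{1..k} \<inter> {..<Suc k} = {1..k}" by auto
  then have "card (maxima T) \<le> card (maxima T \<inter> {..<Suc k})"
    using d card_maxima[OF T] unfolding dominated_def by (metis card_atLeastAtMost diff_Suc_1)
  then have "maxima T \<inter> {..<Suc k} = maxima T"
    by (intro card_seteq) (auto simp: finite_maxima)
  moreover have "1 \<le> a" if "a \<in> maxima T" for a
    using that Max_box_content[OF T] SVT_box(2)[OF T] by (fastforce simp: maxima_def)
  ultimately have "maxima T \<subseteq> {1..k}"
    by (metis IntD2 atLeastAtMost_iff lessThan_iff less_Suc_eq_le subsetI)
  then show "maxima T = {1..k}"
    by (intro card_subset_eq) (auto simp: card_maxima[OF T])
qed

section \<open>Words and the exchange condition\<close>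

lemma word_perm_Nil: "word_perm [] = id"
  by (simp add: word_perm_def)

lemma word_perm_Cons: "word_perm (i # is) = transpose i (Suc i) \<circ> word_perm is"
  by (simp add: word_perm_def)

lemma word_perm_permutes: "set is \<subseteq> {1..<n} \<Longrightarrow> word_perm is permutes {1..n}"
proof (induction "is")
  case Nil
  then show ?case by (simp add: word_perm_Nil permutes_id del: id_apply)
next
  case (Cons i "is")
  then show ?case
    unfolding word_perm_Cons by (intro permutes_compose permutes_swap_id) auto
qed

lemma inj_word_perm: "inj (word_perm is)"
  by (induction "is")
    (simp_all only: word_perm_Nil word_perm_Cons inj_on_id inj_compose inj_transpose)

text \<open>The exchange condition: multiplying by the transposition that removes an inversion
  amounts to deleting a letter.\<close>

lemma exchange:
  assumes "c < d" "word_perm js d < word_perm js c"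
  shows "\<exists>js'. set js' \<subseteq> set js \<and> length js' < length js
    \<and> word_perm js' = transpose (word_perm js c) (word_perm js d) \<circ> word_perm js"
  using assms(2)
proof (induction js)
  case Nil
  then show ?case using assms(1) by (simp add: word_perm_Nil)
next
  case (Cons j js)
  let ?v = "word_perm js" and ?s = "transpose j (Suc j)"
  show ?case
  proof (cases "?v d < ?v c")
    case True
    then obtain js' where js': "set js' \<subseteq> set js" "length js' < length js"
      "word_perm js' = transpose (?v c) (?v d) \<circ> ?v" using Cons.IH by blast
    \<comment> \<open>Conjugation moves the transposition of values past the letter
      \<open>j\<close>.\<close>
    have "?s \<circ> transpose (?v c) (?v d) = transpose (?s (?v c)) (?s (?v d)) \<circ> ?s"
      by (rule ext, unfold o_apply, rule transpose_image_commute[OF inj_transpose])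
    then have "word_perm (j # js')
        = transpose (word_perm (j # js) c) (word_perm (j # js) d) \<circ> word_perm (j # js)"
      by (simp add: word_perm_Cons js' flip: comp_assoc)
    then show ?thesis using js' by (intro exI[of _ "j # js'"]) auto
  next
    case False
    have "?v c \<noteq> ?v d" using inj_word_perm[of js] assms(1) by (auto dest: injD)
    \<comment> \<open>The letter \<open>j\<close> itself creates the inversion, so it is the one to
      delete.\<close>
    then have *: "?v c = j" "?v d = Suc j"
      using False Cons.prems by (auto simp: word_perm_Cons transpose_def split: if_splits)
    then have "word_perm js
        = transpose (word_perm (j # js) c) (word_perm (j # js) d) \<circ> word_perm (j # js)"
      by (simp add: word_perm_Cons fun_eq_iff transpose_commute)
    then show ?thesis by (intro exI[of _ js]) auto
  qed
qed

text \<open>A shorter word for the tail, prefixed by \<open>i\<close>, would be a shorter word for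
  \<open>w\<close>.\<close>

lemma reduced_word_Cons:
  assumes "reduced_word n w (i # is)"
  shows "i \<in> {1..<n}" "w = transpose i (Suc i) \<circ> word_perm is"
    "reduced_word n (word_perm is) is"
  using assms unfolding reduced_word_def
  by (auto simp: word_perm_Cons) (metis Suc_le_mono insert_subset length_Cons list.simps(15)
    atLeastLessThan_iff word_perm_Cons)

text \<open>This is the hypothesis of \<open>dominated_step\<close>. If it failed,
  \<open>Suc i\<close> and \<open>i\<close> would be the values at positions
  \<open>c \<le> k < d\<close>, an inversion, and \<open>exchange\<close> would yield a word for
  \<open>w\<close> shorter even than the tail.\<close>

lemma reduced_word_ascent:
  assumes red: "reduced_word n w (i # is)" and "k \<le> n"
    and Suci: "Suc i \<in> word_perm is ` {1..k}"
  shows "i \<in> word_perm is ` {1..k}"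
proof (rule ccontr)
  assume ni: "i \<notin> word_perm is ` {1..k}"
  let ?v = "word_perm is"
  have i: "i \<in> {1..<n}" and "set is \<subseteq> {1..<n}"
    using red by (auto simp: reduced_word_def)
  then have "?v permutes {1..n}" using word_perm_permutes by blast
  then have "i \<in> ?v ` {1..n}" using i by (simp add: permutes_image)
  then obtain d where d: "d \<in> {1..n}" "?v d = i" by auto
  obtain c where c: "c \<in> {1..k}" "?v c = Suc i" using Suci by auto
  have "c < d" using ni c d by (metis atLeastAtMost_iff imageI leD linorder_le_less_linear
        order.strict_trans1 nat_le_linear order.trans)
  then obtain js where "set js \<subseteq> set is" "length js < length is"
    "word_perm js = transpose i (Suc i) \<circ> ?v"
    using exchange[of c d "is"] c d by (auto simp: transpose_commute)
  then show False
    using red by (fastforce simp: reduced_word_def word_perm_Cons)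
qed

section \<open>Demazure crystals as dominance sets\<close>

lemma SVT_word_Cons:
  assumes "i \<in> {1..<n}"
  shows "SVT_word n k (i # is) = {T \<in> SVT n k. step i T \<in> SVT_word n k is}"
  using step_in_SVT[OF _ assms] by (auto simp: SVT_word_def step_def)

lemma SVT_word_Nil: "k \<le> n \<Longrightarrow> SVT_word n k [] = {ucol k}"
  by (auto simp: SVT_word_def ucol_in_SVT)

text \<open>Each letter moves from the tableau to the subset: by \<open>maxima_step\<close> and
  \<open>dominated_step\<close>, testing the raised maxima against the tail's subset amounts to
  applying the transposition to that subset. The empty word is
  \<open>dominated_initial\<close>.\<close>

lemma SVT_word_eq:
  assumes "reduced_word n w is" "k \<le> n"
  shows "SVT_word n k is = {T \<in> SVT n k. dominated (w ` {1..k}) (maxima T)}"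
  using assms(1)
proof (induction "is" arbitrary: w)
  case Nil
  then have "w = id" by (simp add: reduced_word_def word_perm_Nil)
  then show ?case
    using dominated_initial assms(2)
    by (auto simp: SVT_word_Nil ucol_in_SVT maxima_ucol dominated_def)
next
  case (Cons i "is")
  note r = reduced_word_Cons[OF Cons.prems]
  have "step i T \<in> SVT_word n k is \<longleftrightarrow> dominated (w ` {1..k}) (maxima T)"
    if T: "T \<in> SVT n k" for T
    using dominated_step[of i "word_perm is ` {1..k}" "maxima T"]
      reduced_word_ascent[OF Cons.prems assms(2)] T step_in_SVT[OF T r(1)]
    by (simp add: Cons.IH[OF r(3)] maxima_step[OF T] r(2) image_comp)
  then show ?case using SVT_word_Cons[OF r(1)] by auto
qed

subsection \<open>Strings\<close>

lemma lower_image: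
  "lower i ` A = (if Suc i \<in> A then insert i (A - {Suc i}) else A)"
  by (force simp: lower_def)

lemma f_op_Some_iff:
  "(\<exists>T. f_op i h = Some T) \<longleftrightarrow> i \<in> content h \<and> Suc i \<notin> content h"
  "(\<exists>T. fK_op i h = Some T) \<longleftrightarrow> i \<in> content h \<and> Suc i \<notin> content h"
  by (auto simp: f_op_def fK_op_def)

lemma f_op_content:
  assumes "f_op i h = Some T"
  shows "i \<in> content h" "Suc i \<notin> content h" "content T = insert (Suc i) (content h - {i})"
proof -
  show i: "i \<in> content h" "Suc i \<notin> content h"
    using assms by (auto simp: f_op_def split: if_splits)
  let ?up = "\<lambda>a. if a = i then Suc i else a"
  have up: "?up ` A = (if i \<in> A then insert (Suc i) (A - {i}) else A)" for A by force
  have "T = map (image ?up) h"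
    unfolding up using assms i by (simp add: f_op_def)
  then have "content T = ?up ` content h" by (simp only: content_map_image)
  then show "content T = insert (Suc i) (content h - {i})" using i by (simp only: up if_True)
qed

lemma fK_op_content:
  assumes "fK_op i h = Some T"
  shows "i \<in> content h" "Suc i \<notin> content h" "content T = insert (Suc i) (content h)"
proof -
  show i: "i \<in> content h" "Suc i \<notin> content h"
    using assms by (auto simp: fK_op_def split: if_splits)
  have "T = map (\<lambda>A. if i \<in> A then insert (Suc i) A else A) h"
    using assms i by (simp add: fK_op_def)
  then have "x \<in> content T \<longleftrightarrow> (\<exists>A\<in>set h. x \<in> A \<or> i \<in> A \<and> x = Suc i)" for x
    by (auto simp: content_def simp del: Int_Collect)
  then show "content T = insert (Suc i) (content h)" using i by (auto simp: content_def)
qed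

text \<open>Both moves place \<open>Suc i\<close> in the box of \<open>i\<close>, so the result is
  not separated, and \<open>lower i\<close> undoes either of them.\<close>

lemma step_f_op:
  assumes h: "h \<in> SVT n k" and i: "i \<in> {1..<n}"
    and T: "f_op i h = Some T \<or> fK_op i h = Some T"
  shows "T \<in> SVT n k" "step i T = h"
proof -
  show TS: "T \<in> SVT n k" using T ops_closed[OF h i] by blast
  have "Suc i \<notin> content h" using T f_op_content(2) fK_op_content(2) by blast
  then have ni: "Suc i \<notin> A" if "A \<in> set h" for A using that by (auto simp: content_def)
  have "\<not> separated i T \<and> map (image (lower i)) T = h"
    using T
  proof
    assume f: "f_op i h = Some T"
    then have T_eq: "T = map (\<lambda>A. if i \<in> A then insert (Suc i) (A - {i}) else A) h"
      by (auto simp: f_op_def split: if_splits)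
    have "i \<notin> content T" using f_op_content(3)[OF f] by simp
    then have "\<not> separated i T" by (auto simp: separated_def content_def)
    moreover have "lower i ` (if i \<in> A then insert (Suc i) (A - {i}) else A) = A"
      if "A \<in> set h" for A
      using ni[OF that] by (auto simp: lower_image simp del: image_insert)
    then have "map (image (lower i)) T = h"
      unfolding T_eq map_map o_def by (rule map_idI)
    ultimately show ?thesis by blast
  next
    assume f: "fK_op i h = Some T"
    then have T_eq: "T = map (\<lambda>A. if i \<in> A then insert (Suc i) A else A) h"
      by (auto simp: fK_op_def split: if_splits)
    then have "\<not> separated i T"
      by (auto simp: separated_def split: if_splits)
    moreover have "lower i ` (if i \<in> A then insert (Suc i) A else A) = A"
      if "A \<in> set h" for A
      using ni[OF that] by (auto simp: lower_image simp del: image_insert)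
    then have "map (image (lower i)) T = h"
      unfolding T_eq map_map o_def by (rule map_idI)
    ultimately show ?thesis by blast
  qed
  then show "step i T = h" by (simp add: step_eq[OF TS])
qed

text \<open>A tableau moved by \<open>step i\<close> contains \<open>Suc i\<close>, either without
  \<open>i\<close>, and then comes from \<open>f_op\<close>, or in the same box as \<open>i\<close>,
  and then comes from \<open>fK_op\<close>.\<close>

lemma step_preimage:
  assumes T: "T \<in> SVT n k" and h: "step i T = h" and ne: "T \<noteq> h"
  shows "f_op i h = Some T \<or> fK_op i h = Some T"
proof -
  have nsep: "\<not> separated i T" and h_eq: "h = map (image (lower i)) T"
    using h ne by (auto simp: step_eq[OF T] split: if_splits)
  have Suci: "Suc i \<in> content T" using h_eq ne map_lower_id by metis
  then have c: "i \<in> content h" "Suc i \<notin> content h"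
    by (auto simp: h_eq content_map_image lower_image)
  show ?thesis
  proof (cases "i \<in> content T")
    case False
    then have "\<forall>A\<in>set T. i \<notin> A" by (auto simp: content_def)
    then have "(if i \<in> lower i ` A then insert (Suc i) (lower i ` A - {i}) else lower i ` A) = A"
      if "A \<in> set T" for A
      using that by (cases "Suc i \<in> A") (auto simp: lower_image)
    then have "map (\<lambda>A. if i \<in> A then insert (Suc i) (A - {i}) else A) h = T"
      unfolding h_eq map_map o_def by (rule map_idI)
    then show ?thesis using c by (simp add: f_op_def)
  next
    case True
    then obtain B where B: "B \<in> set T" "i \<in> B" by (auto simp: content_def)
    have "\<forall>A\<in>set T. i \<in> A \<longrightarrow> Suc i \<in> A" using nsep Suci by (auto simp: separated_def)
    moreover from this have "\<forall>A\<in>set T. Suc i \<in> A \<longrightarrow> i \<in> A"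
      using SVT_box_unique[OF T B(1), of _ "Suc i"] B by blast
    ultimately have "(if i \<in> lower i ` A then insert (Suc i) (lower i ` A) else lower i ` A) = A"
      if "A \<in> set T" for A
      using that by (cases "Suc i \<in> A") (auto simp: lower_image)
    then have "map (\<lambda>A. if i \<in> A then insert (Suc i) A else A) h = T"
      unfolding h_eq map_map o_def by (rule map_idI)
    then show ?thesis using c by (simp add: fK_op_def)
  qed
qed

text \<open>The image under \<open>lower i\<close> lacks \<open>Suc i\<close>, so a fixed tableau
  containing \<open>Suc i\<close> must be separated.\<close>

lemma step_fixed:
  assumes T: "T \<in> SVT n k" and "step i T = T"
  shows "Suc i \<in> content T \<Longrightarrow> separated i T"
    and "e_op i T = None" "eK_op i T = None"
proof -
  have *: "Suc i \<in> content T \<Longrightarrow> separated i T"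
    using assms by (metis Suc_notin_lower content_map_image step_eq)
  then show "Suc i \<in> content T \<Longrightarrow> separated i T" .
  show "e_op i T = None" "eK_op i T = None"
    using * separated_ops_None[OF T] ops_None_if_Suc_notin by blast+
qed

text \<open>The changed boxes differ only in \<open>i\<close>, which lies below
  \<open>Suc i\<close>. Hence a condition on maxima cannot tell the two non-heads of a string
  apart.\<close>

lemma maxima_f_op:
  assumes h: "h \<in> SVT n k" and "f_op i h = Some T" "fK_op i h = Some T'"
  shows "maxima T = maxima T'"
proof -
  have "Max (insert (Suc i) (A - {i})) = Max (insert (Suc i) A)" if "A \<in> set h" "i \<in> A" for A
  proof -
    have "finite A" using SVT_box(3)[OF h that(1)] .
    then have "Max (insert i (insert (Suc i) (A - {i}))) = max i (Max (insert (Suc i) (A - {i})))"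
      by (intro Max_insert) auto
    moreover have "Suc i \<le> Max (insert (Suc i) (A - {i}))" using \<open>finite A\<close> by simp
    moreover have "insert i (insert (Suc i) (A - {i})) = insert (Suc i) A" using that by auto
    ultimately show ?thesis by simp
  qed
  moreover have "T = map (\<lambda>A. if i \<in> A then insert (Suc i) (A - {i}) else A) h"
    "T' = map (\<lambda>A. if i \<in> A then insert (Suc i) A else A) h"
    using assms by (auto simp: f_op_def fK_op_def split: if_splits)
  ultimately show ?thesis
    unfolding maxima_def by (simp only: set_map image_image) (rule image_cong, simp_all)
qed

text \<open>For \<open>i\<close> not in \<open>M\<close> the map \<open>lower i\<close> is injective
  on \<open>M\<close> and never increases an element, so no count drops. This puts the head into a
  crystal that contains another member of its string.\<close>

lemma dominated_lower:
  assumes "dominated J M" "finite M"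
  shows "dominated J (if i \<in> M then M else lower i ` M)"
proof (cases "i \<in> M")
  case False
  have "card (M \<inter> {..<m}) \<le> card (lower i ` M \<inter> {..<m})" for m
  proof -
    have "inj_on (lower i) (M \<inter> {..<m})" using False by (auto simp: inj_on_def lower_def)
    then have "card (M \<inter> {..<m}) = card (lower i ` (M \<inter> {..<m}))" by (simp add: card_image)
    also have "\<dots> \<le> card (lower i ` M \<inter> {..<m})"
      using assms(2) by (intro card_mono) (auto simp: lower_def)
    finally show ?thesis .
  qed
  then show ?thesis using assms False by (auto simp: dominated_def intro: order_trans)
qed (use assms in simp)

section \<open>Connectedness\<close>

text \<open>Unless the tableau is \<open>ucol k\<close>, \<open>unique_highest\<close> provides an
  index at which \<open>step\<close> moves it, and the move lowers the sum of the content.\<close>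

lemma connected_ucol:
  assumes "T \<in> SVT n k" "k \<le> n"
  shows "(ucol k, T) \<in> (svt_edges n k)\<^sup>*"
  using assms(1)
proof (induction "\<Sum>(content T)" arbitrary: T rule: less_induct)
  case less
  show ?case
  proof (cases "T = ucol k")
    case False
    then obtain i where i: "i \<in> {1..<n}" and "step i T \<noteq> T"
      using unique_highest[OF less.prems] step_fixed[OF less.prems] by metis
    define h where "h = step i T"
    have h: "h \<in> SVT n k" using step_in_SVT[OF less.prems i] by (simp add: h_def)
    have f: "f_op i h = Some T \<or> fK_op i h = Some T"
      using step_preimage[OF less.prems h_def[symmetric]] \<open>step i T \<noteq> T\<close> h_def by simp
    have fin: "finite (content h)" using SVT_content[OF h] finite_subset by blast
    have "\<Sum>(content h) < \<Sum>(content T)"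
      using f
    proof
      assume "f_op i h = Some T"
      note c = f_op_content[OF this]
      show ?thesis
        using c fin by (simp add: sum.remove[of "content h" i])
    next
      assume "fK_op i h = Some T"
      note c = fK_op_content[OF this]
      show ?thesis using c fin by simp
    qed
    then have "(ucol k, h) \<in> (svt_edges n k)\<^sup>*" using less.hyps h by blast
    moreover have "(h, T) \<in> svt_edges n k" using h less.prems i f by (auto simp: svt_edges_def)
    ultimately show ?thesis by (rule rtrancl_into_rtrancl)
  qed simp
qed

subsection \<open>Demazure--Lascoux operators on strings\<close>

text \<open>Values occur in at most one box, so the weight monomial is squarefree and given by the
  content.\<close>

definition mono_term :: "column \<Rightarrow> mpol" where
  "mono_term T = Beta ^ excess T * (\<Prod>j\<in>content T. X j)"

text \<open>The boxes partition the content; being nonempty, none is truncated by the subtraction in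
  \<open>excess\<close>.\<close>

lemma excess_card:
  assumes T: "T \<in> SVT n k"
  shows "excess T + k = card (content T)"
proof -
  have len: "length T = k" using T by (simp add: SVT_iff)
  have c: "content T = (\<Union>r\<in>{..<k}. T ! r)"
    by (auto simp: content_def len[symmetric] set_conv_nth)
  have box: "T ! r \<noteq> {} \<and> finite (T ! r)" if "r < k" for r
    using SVT_box[OF T, of "T ! r"] that len by simp
  have "card (content T) = (\<Sum>r<k. card (T ! r))"
    unfolding c
    using box SVT_index_unique[OF T] by (intro card_UN_disjoint) auto
  also have "\<dots> = (\<Sum>r<k. (card (T ! r) - 1) + 1)"
    using box by (intro sum.cong) (auto simp: Suc_le_eq card_gt_0_iff)
  also have "\<dots> = excess T + k" by (simp only: sum.distrib) (simp add: excess_def len)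
  finally show ?thesis by simp
qed

lemma mono_term_eq:
  assumes T: "T \<in> SVT n k"
  shows "Beta ^ excess T * (\<Prod>j\<in>{1..n}. X j ^ weight T j) = mono_term T"
proof -
  have len: "length T = k" using T by (simp add: SVT_iff)
  have w: "weight T j = (if j \<in> content T then 1 else 0)" for j
  proof (cases "j \<in> content T")
    case True
    then obtain r where r: "r < k" "j \<in> T ! r"
      using len by (auto simp: content_def in_set_conv_nth)
    then have "{r. r < length T \<and> j \<in> T ! r} = {r}"
      using SVT_index_unique[OF T] len by auto
    then show ?thesis using True by (simp add: weight_def)
  next
    case False
    then have "{r. r < length T \<and> j \<in> T ! r} = {}" by (auto simp: content_def)
    then show ?thesis using False by (simp add: weight_def)
  qed
  have "(\<Prod>j\<in>{1..n}. X j ^ weight T j) = (\<Prod>j\<in>content T. X j ^ weight T j)"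
    using SVT_content[OF T] by (intro prod.mono_neutral_right) (auto simp: w)
  also have "\<dots> = (\<Prod>j\<in>content T. X j)" by (simp add: w)
  finally show ?thesis by (simp add: mono_term_def)
qed

section \<open>Swapping variables as a ring homomorphism\<close>

lemma swap_vars_zero: "swap_vars i 0 = 0"
  by (simp add: swap_vars_def map_key_zero[OF inj_swap_exps])

text \<open>\<open>update_induct\<close> recast for additive maps: updating a fresh key is adding a
  monomial.\<close>

lemma mpol_induct [case_names zero add]:
  fixes p :: mpol
  assumes "P 0" and add: "\<And>p m c. P p \<Longrightarrow> P (p + Poly_Mapping.single m c)"
  shows "P p"
proof (induction p rule: update_induct)
  case (update p m c)
  have "Poly_Mapping.update m c p = p + Poly_Mapping.single m c"
    using update.hyps
    by (intro poly_mapping_eqI) (auto simp: lookup_update lookup_add lookup_single in_keys_iff)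
  then show ?case using add[OF update.IH] by simp
qed (rule assms(1))

lemma swap_exps_add: "swap_exps i (a + b) = swap_exps i a + swap_exps i b"
  unfolding swap_exps_def by (rule map_key_plus[OF inj_transpose])

lemma swap_vars_mult: "swap_vars i (p * q) = swap_vars i p * swap_vars i q"
proof (induction p rule: mpol_induct)
  case zero
  then show ?case by (simp add: swap_vars_zero)
next
  case (add p m c)
  \<comment> \<open>Bilinearity reduces the claim to two monomials.\<close>
  have "swap_vars i (Poly_Mapping.single m c * q) = swap_vars i (Poly_Mapping.single m c) * swap_vars i q"
    by (induction q rule: mpol_induct)
      (simp_all add: swap_vars_zero swap_vars_add swap_vars_single mult_single swap_exps_add
        distrib_left)
  with add show ?case by (simp add: swap_vars_add distrib_right)
qed

lemma swap_exps_zero: "swap_exps i 0 = 0"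
  unfolding swap_exps_def by (rule map_key_zero[OF inj_transpose])

lemma swap_vars_X: "swap_vars i (X j) = X (transpose i (Suc i) j)"
proof -
  have "swap_exps i (Poly_Mapping.single j 1) = Poly_Mapping.single (transpose i (Suc i) j) 1"
    unfolding swap_exps_def
    by (rule poly_mapping_eqI) (auto simp: map_key.rep_eq[OF inj_transpose] lookup_single when_def)
  then show ?thesis by (simp add: X_def swap_vars_single)
qed

lemma swap_vars_Beta: "swap_vars i Beta = Beta"
  by (simp add: Beta_def swap_vars_single swap_exps_zero)

lemma swap_vars_one: "swap_vars i 1 = 1"
  unfolding single_one[symmetric] by (simp only: swap_vars_single swap_exps_zero)

lemma swap_vars_power: "swap_vars i (p ^ e) = swap_vars i p ^ e"
  by (induction e) (simp_all add: swap_vars_one swap_vars_mult)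

lemma swap_vars_prod: "swap_vars i (\<Prod>j\<in>S. p j) = (\<Prod>j\<in>S. swap_vars i (p j))"
  by (induction S rule: infinite_finite_induct) (simp_all add: swap_vars_one swap_vars_mult)

lemma swap_vars_monomial:
  "swap_vars i (Beta ^ e * (\<Prod>j\<in>S. X j)) = Beta ^ e * (\<Prod>j\<in>transpose i (Suc i) ` S. X j)"
  by (simp add: swap_vars_mult swap_vars_power swap_vars_prod swap_vars_Beta swap_vars_X
      prod.reindex inj_on_subset[OF inj_transpose])

lemma X_diff_nonzero: "X i - X (Suc i) \<noteq> 0"
proof -
  have "Poly_Mapping.single i (1::nat) \<noteq> Poly_Mapping.single (Suc i) 1"
    by (metis lookup_single_eq lookup_single_not_eq n_not_Suc_n zero_neq_one)
  then show ?thesis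
    unfolding X_def by (metis eq_iff_diff_eq_0 lookup_single_eq lookup_single_not_eq zero_neq_one)
qed

section \<open>Division-free rules for the operators\<close>

text \<open>Cancelling the nonzero \<open>X i - X (Suc i)\<close> turns values of \<open>DL\<close>
  into polynomial identities. The term with beta is invariant under the swap.\<close>

lemma DL_eqI:
  assumes "(X i - X (Suc i)) * q = (X i + Beta * X i * X (Suc i)) * p
    - (X (Suc i) + Beta * X i * X (Suc i)) * swap_vars i p"
  shows "DL i p = q"
proof -
  have "swap_vars i ((X i + Beta * X i * X (Suc i)) * p)
      = (X (Suc i) + Beta * X i * X (Suc i)) * swap_vars i p"
    by (simp add: swap_vars_mult swap_vars_add swap_vars_X swap_vars_Beta mult_ac)
  then have "(X i - X (Suc i)) * DL i p = (X i - X (Suc i)) * q"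
    using assms by (simp add: DL_def divdiff_eq)
  then show ?thesis using X_diff_nonzero by (metis mult_left_cancel)
qed

text \<open>The terms with beta cancel, leaving \<open>X i - X (Suc i)\<close> times
  \<open>p\<close>.\<close>

lemma DL_symmetric: "swap_vars i p = p \<Longrightarrow> DL i p = p"
  by (rule DL_eqI) (simp add: algebra_simps)

text \<open>In use, \<open>X i * m\<close> is the monomial of a string's head, and the three terms
  belong to the head, its \<open>f_op\<close> image and its \<open>fK_op\<close> image.\<close>

lemma DL_head:
  assumes "swap_vars i m = m"
  shows "DL i (X i * m) = X i * m + X (Suc i) * m + Beta * X i * X (Suc i) * m"
  by (rule DL_eqI) (simp add: swap_vars_mult swap_vars_X assms algebra_simps)

lemma DL_string:
  assumes "swap_vars i m = m"
  shows "DL i (X i * m + X (Suc i) * m + Beta * X i * X (Suc i) * m)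
    = X i * m + X (Suc i) * m + Beta * X i * X (Suc i) * m"
  by (rule DL_symmetric)
    (simp add: swap_vars_add swap_vars_mult swap_vars_X swap_vars_Beta assms algebra_simps)

lemma DL_zero: "DL i 0 = 0"
  by (rule DL_symmetric) (rule swap_vars_zero)

lemma DL_add: "DL i (p + q) = DL i p + DL i q"
proof -
  have "(X i - X (Suc i)) * DL i (p + q) = (X i - X (Suc i)) * (DL i p + DL i q)"
    by (simp add: DL_def divdiff_eq distrib_left swap_vars_add)
  then show ?thesis using X_diff_nonzero by (metis mult_left_cancel)
qed

lemma DL_sum: "DL i (\<Sum>a\<in>S. p a) = (\<Sum>a\<in>S. DL i (p a))"
  by (induction S rule: infinite_finite_induct) (simp_all add: DL_zero DL_add)

section \<open>Characters, one string at a time\<close>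

text \<open>The fibre of \<open>step i\<close> over \<open>h\<close> is a full string,
  \<open>{h}\<close> or empty. By \<open>string\<close>, a full string meets \<open>S\<close> in
  nothing, the head or everything, settled by \<open>DL_zero\<close>, \<open>DL_head\<close> and
  \<open>DL_string\<close>; a singleton fibre has a symmetric monomial.\<close>

lemma DL_fibre:
  assumes i: "i \<in> {1..<n}" and h: "h \<in> SVT n k" and S: "S \<subseteq> SVT n k"
    and string: "\<And>T T'. f_op i h = Some T \<Longrightarrow> fK_op i h = Some T'
      \<Longrightarrow> (T \<in> S \<longleftrightarrow> T' \<in> S) \<and> (T \<in> S \<longrightarrow> h \<in> S)"
  shows "DL i (\<Sum>T\<in>{T \<in> S. step i T = h}. mono_term T)
    = (\<Sum>T\<in>{T \<in> SVT n k. step i T = h \<and> h \<in> S}. mono_term T)"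
proof (cases "i \<in> content h \<and> Suc i \<notin> content h")
  case True
  then obtain T T' where T: "f_op i h = Some T" and T': "fK_op i h = Some T'"
    using f_op_Some_iff by metis
  note cT = f_op_content[OF T] and cT' = fK_op_content[OF T']
  have TS: "T \<in> SVT n k" "step i T = h" "T' \<in> SVT n k" "step i T' = h"
    using step_f_op[OF h i] T T' by blast+
  have hh: "step i h = h"
    using True by (simp add: step_eq[OF h] map_lower_id)
  have fibre: "{T \<in> SVT n k. step i T = h} = {h, T, T'}"
    using TS h hh step_preimage[of _ n k i h] T T' by auto
  have "Suc i \<in> content T" "Suc i \<in> content T'" "i \<notin> content T" "i \<in> content T'"
    using cT cT' by simp_all
  then have ne: "h \<noteq> T" "h \<noteq> T'" "T \<noteq> T'" using True by auto
  have fin: "finite (content h)" using SVT_content[OF h] finite_subset by blast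
  \<comment> \<open>The head's monomial without \<open>X i\<close>; neither variable remains, so it
    is symmetric.\<close>
  define m where "m = Beta ^ excess h * (\<Prod>j\<in>content h - {i}. X j)"
  have "transpose i (Suc i) ` (content h - {i}) = content h - {i}"
    using True by (force simp: transpose_def)
  then have m: "swap_vars i m = m" by (simp add: m_def swap_vars_monomial)
  have card: "card (content h - {i}) = card (content h) - 1" "0 < card (content h)"
    using True fin by (auto simp: card_gt_0_iff)
  have "excess T = excess h"
    using excess_card[OF TS(1)] excess_card[OF h] cT fin card by simp
  moreover have "excess T' = Suc (excess h)"
    using excess_card[OF TS(3)] excess_card[OF h] cT' fin by simp
  moreover have "(\<Prod>j\<in>content h. X j) = X i * (\<Prod>j\<in>content h - {i}. X j)"
    using True fin by (simp add: prod.remove)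
  ultimately have mono: "mono_term h = X i * m" "mono_term T = X (Suc i) * m"
    "mono_term T' = Beta * X i * X (Suc i) * m"
    using cT cT' fin by (simp_all add: mono_term_def m_def mult_ac)
  have all: "(\<Sum>T\<in>{h, T, T'}. mono_term T)
      = X i * m + X (Suc i) * m + Beta * X i * X (Suc i) * m"
    using ne by (simp add: mono add_ac)
  have SF: "{T \<in> S. step i T = h} = S \<inter> {h, T, T'}" using fibre S by blast
  consider "h \<notin> S" | "h \<in> S" "T \<notin> S" | "h \<in> S" "T \<in> S" by blast
  then show ?thesis
  proof cases
    case 1
    then have e: "{T \<in> S. step i T = h} = {}" unfolding SF using string[OF T T'] by blast
    then show ?thesis unfolding e using 1 by (simp add: DL_zero)
  next
    case 2
    then have "{T \<in> S. step i T = h} = {h}" unfolding SF using string[OF T T'] by blast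
    then show ?thesis using 2 DL_head[OF m] by (simp add: fibre all mono(1))
  next
    case 3
    then have "{T \<in> S. step i T = h} = {h, T, T'}" unfolding SF using string[OF T T'] by blast
    then show ?thesis using 3 DL_string[OF m] by (simp add: fibre all)
  qed
next
  case False
  have sub: "T = h" if "T \<in> SVT n k" "step i T = h" for T
    using step_preimage[OF that] False f_op_content fK_op_content by blast
  show ?thesis
  proof (cases "step i h = h \<and> h \<in> S")
    case True
    \<comment> \<open>A fixed \<open>h\<close> containing \<open>Suc i\<close> is separated, hence
      contains \<open>i\<close>; the converse is the failed case condition.\<close>
    then have "i \<in> content h \<longleftrightarrow> Suc i \<in> content h"
      using False step_fixed(1)[OF h] by (auto simp: separated_def content_def)
    then have "transpose i (Suc i) ` content h = content h"
      by (simp add: transpose_image_eq)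
    then have "swap_vars i (mono_term h) = mono_term h"
      by (simp add: mono_term_def swap_vars_monomial)
    moreover have "T \<in> SVT n k \<and> step i T = h \<longleftrightarrow> T = h" for T using True sub h by blast
    then have "{T \<in> S. step i T = h} = {h}" "{T \<in> SVT n k. step i T = h \<and> h \<in> S} = {h}"
      using True S by auto
    ultimately show ?thesis by (simp only: sum.insert sum.empty finite.emptyI empty_iff
          not_False_eq_True add_0_right DL_symmetric)
  next
    case no: False
    \<comment> \<open>Every fibre element is \<open>h\<close> itself, so the fibre is empty or its
      only member lies outside \<open>S\<close>.\<close>
    have "\<not> (T \<in> SVT n k \<and> step i T = h \<and> (T \<in> S \<or> h \<in> S))" for T
    proof
      assume T: "T \<in> SVT n k \<and> step i T = h \<and> (T \<in> S \<or> h \<in> S)"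
      then have "T = h" by (simp add: sub)
      with T no show False by simp
    qed
    then have "{T \<in> S. step i T = h} = {}" "{T \<in> SVT n k. step i T = h \<and> h \<in> S} = {}"
      using S by auto
    then show ?thesis by (simp only: sum.empty DL_zero)
  qed
qed

text \<open>Split \<open>S\<close> into fibres of \<open>step i\<close>, apply
  \<open>DL_fibre\<close> to each by additivity, and reassemble: exactly the fibres over members of
  \<open>S\<close> remain, now complete.\<close>

lemma DL_character:
  assumes i: "i \<in> {1..<n}" and S: "S = {T \<in> SVT n k. dominated J (maxima T)}"
  shows "DL i (\<Sum>T\<in>S. mono_term T) = (\<Sum>T\<in>{T \<in> SVT n k. step i T \<in> S}. mono_term T)"
proof -
  have fin: "finite S" unfolding S using finite_SVT by simp
  have img: "step i ` S \<subseteq> SVT n k" using S step_in_SVT[OF _ i] by auto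
  \<comment> \<open>The two non-heads share their maxima, and raising the maxima preserves
    dominance.\<close>
  have string: "(T \<in> S \<longleftrightarrow> T' \<in> S) \<and> (T \<in> S \<longrightarrow> h \<in> S)"
    if h: "h \<in> SVT n k" and T: "f_op i h = Some T" and T': "fK_op i h = Some T'" for h T T'
  proof -
    have TS: "T \<in> SVT n k" "step i T = h" "T' \<in> SVT n k"
      using step_f_op[OF h i] T T' by blast+
    then show ?thesis
      using h maxima_f_op[OF h T T'] dominated_lower[of J "maxima T" i] maxima_step[OF TS(1), of i]
      by (auto simp: S finite_maxima)
  qed
  have "DL i (\<Sum>T\<in>S. mono_term T)
      = DL i (\<Sum>h\<in>SVT n k. \<Sum>T\<in>{T \<in> S. step i T = h}. mono_term T)"
    by (simp only: sum.group[OF fin finite_SVT img])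
  also have "\<dots> = (\<Sum>h\<in>SVT n k. \<Sum>T\<in>{T \<in> SVT n k. step i T = h \<and> h \<in> S}. mono_term T)"
  proof (subst DL_sum, rule sum.cong[OF refl])
    fix h assume h: "h \<in> SVT n k"
    show "DL i (\<Sum>T\<in>{T \<in> S. step i T = h}. mono_term T)
        = (\<Sum>T\<in>{T \<in> SVT n k. step i T = h \<and> h \<in> S}. mono_term T)"
      by (rule DL_fibre[OF i h _ string[OF h]]) (auto simp: S)
  qed
  also have "\<dots> = (\<Sum>h\<in>SVT n k. \<Sum>T\<in>{T \<in> {T \<in> SVT n k. step i T \<in> S}. step i T = h}. mono_term T)"
    by (intro sum.cong) auto
  also have "\<dots> = (\<Sum>T\<in>{T \<in> SVT n k. step i T \<in> S}. mono_term T)"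
    using step_in_SVT[OF _ i] by (intro sum.group) (auto simp: finite_SVT)
  finally show ?thesis .
qed

text \<open>The first letter acts first on tableaux, while its operator is outermost in
  \<open>foldr\<close>, so one induction step strips both. \<open>SVT_word_eq\<close> gives the
  tail's crystal the form that \<open>DL_character\<close> requires.\<close>

lemma SVT_word_character:
  assumes "reduced_word n w is" "k \<le> n"
  shows "(\<Sum>T\<in>SVT_word n k is. mono_term T) = foldr DL is (\<Prod>j\<in>{1..k}. X j)"
  using assms(1)
proof (induction "is" arbitrary: w)
  case Nil
  have "excess (ucol k) = 0" using excess_card[OF ucol_in_SVT[OF assms(2)]] by (simp add: content_ucol)
  then show ?case
    by (simp add: SVT_word_Nil[OF assms(2)] mono_term_def content_ucol)
next
  case (Cons i "is")
  note r = reduced_word_Cons[OF Cons.prems]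
  show ?case
    using DL_character[OF r(1) SVT_word_eq[OF r(3) assms(2)]] Cons.IH[OF r(3)]
    by (simp add: SVT_word_Cons[OF r(1)])
qed

theorem theorem7p9:
  fixes n k :: nat
  assumes "n \<ge> 2" and "1 \<le> k" and "k \<le> n"
  shows
    "(\<forall>T\<in>SVT n k. \<forall>T'\<in>SVT n k. (T, T') \<in> (svt_edges n k \<union> (svt_edges n k)\<inverse>)\<^sup>*)
     \<and> {T \<in> SVT n k. \<forall>i\<in>{1..<n}. e_op i T = None \<and> eK_op i T = None} = {ucol k}
     \<and> (\<forall>w is js. w permutes {1..n} \<longrightarrow> reduced_word n w is \<longrightarrow> reduced_word n w js
          \<longrightarrow> SVT_word n k is = SVT_word n k js)
     \<and> (\<forall>w is. w permutes {1..n} \<longrightarrow> reduced_word n w is \<longrightarrow>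
          (\<Sum>T\<in>SVT_word n k is. Beta ^ excess T * (\<Prod>j\<in>{1..n}. X j ^ weight T j))
            = foldr DL is (\<Prod>j\<in>{1..k}. X j))"
proof (intro conjI ballI allI impI)
  fix T T' assume TT': "T \<in> SVT n k" "T' \<in> SVT n k"
  let ?R = "(svt_edges n k \<union> (svt_edges n k)\<inverse>)\<^sup>*"
  \<comment> \<open>Any two tableaux are joined through \<open>ucol k\<close>, from which directed
    paths reach both.\<close>
  have sym: "sym ?R" by (intro sym_rtrancl) (auto simp: sym_def)
  have "(ucol k, T) \<in> ?R" "(ucol k, T') \<in> ?R"
    using connected_ucol[OF _ assms(3)] TT' rtrancl_mono[of "svt_edges n k"] by blast+
  then show "(T, T') \<in> ?R" using sym by (meson rtrancl_trans symD)
next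
  show "{T \<in> SVT n k. \<forall>i\<in>{1..<n}. e_op i T = None \<and> eK_op i T = None} = {ucol k}"
  proof (intro equalityI subsetI)
    fix T assume "T \<in> {T \<in> SVT n k. \<forall>i\<in>{1..<n}. e_op i T = None \<and> eK_op i T = None}"
    then have "T = ucol k" by (intro unique_highest[of T n k]) blast+
    then show "T \<in> {ucol k}" by simp
  next
    fix T assume "T \<in> {ucol k}"
    then show "T \<in> {T \<in> SVT n k. \<forall>i\<in>{1..<n}. e_op i T = None \<and> eK_op i T = None}"
      using ucol_in_SVT[OF assms(3)] ucol_ops_None[of _ k] by (simp del: not_None_eq)
  qed
next
  fix w "is" js assume "reduced_word n w is" "reduced_word n w js"
  \<comment> \<open>\<open>SVT_word_eq\<close> describes both sets by the permutation
    \<open>w\<close>, without its words.\<close>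
  then show "SVT_word n k is = SVT_word n k js" by (simp add: SVT_word_eq assms(3))
next
  fix w "is" assume r: "reduced_word n w is"
  have "(\<Sum>T\<in>SVT_word n k is. Beta ^ excess T * (\<Prod>j\<in>{1..n}. X j ^ weight T j))
      = (\<Sum>T\<in>SVT_word n k is. mono_term T)"
    by (intro sum.cong refl mono_term_eq[of _ n k]) (simp add: SVT_word_def)
  then show "(\<Sum>T\<in>SVT_word n k is. Beta ^ excess T * (\<Prod>j\<in>{1..n}. X j ^ weight T j))
      = foldr DL is (\<Prod>j\<in>{1..k}. X j)"
    using SVT_word_character[OF r assms(3)] by simp
qed

end
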